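(* Let $n\ge1$ be a fixed degree. The unitary best approximation $r_\omega(\mathrm{i}x)\approx\mathrm{e}^{\mathrm{i}\omega x}$ in $\mathcal{U}_n$, which has minimal degree $n$ for $\omega\in(0,(n+1)\pi)$, continuously extends to $\omega=0$ with $r_0\equiv1$, i.e., $$\|r_\omega-1\|\to0,\quad\omega\to0^+.$$ For $\omega=0$ the approximation $r_0\equiv1$ is exact but degenerate (its minimal degree is smaller than $n$).
   Context: For a complex polynomial $p$ let $p^\dag(z):=\overline{p}(-z)=\overline{p(-\overline z)}$, where $\overline p$ has complex-conjugated coefficients. Let $\mathcal{U}_n:=\{p^\dag/p : p \text{ a complex polynomial of degree}\le n,\ p\not\equiv 0\}$, with rational functions identified with their irreducible form; then $|r(\mathrm{i}x)|=1$ for $r\in\mathcal{U}_n$, $x\in\mathbb{R}$. The minimal degree of $r$ is the smallest $m$ such that $r$ is a quotient of two polynomials of degree $\le m$. For a complex function $f$ let $\|f\|:=\max_{x\in[-1,1]}|f(\mathrm{i}x)|$; so $\|r-\exp(\omega\cdot)\|=\max_{x\in[-1,1]}|r(\mathrm{i}x)-\mathrm{e}^{\mathrm{i}\omega x}|$. For $\omega\in(0,(n+1)\pi)$ the unitary best approximation $r_\omega$ is the (existing and unique) element of $\mathcal{U}_n$ with $\|r_\omega-\exp(\omega\cdot)\|=\min_{u\in\mathcal{U}_n}\|u-\exp(\omega\cdot)\|$. *)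

theory Defs
  imports
    "HOL-Analysis.Analysis"
    "HOL-Computational_Algebra.Computational_Algebra"
    "HOL-Computational_Algebra.Field_as_Ring"
begin

definition dagger :: "complex poly \<Rightarrow> complex poly" where
  "dagger p = pcompose (map_poly cnj p) [:0, -1:]"

lemma poly_dagger: "poly (dagger p) z = cnj (poly p (- cnj z))"
proof -
  have "poly (map_poly cnj p) w = cnj (poly p (cnj w))" for w
    by (induction p) (simp_all add: map_poly_pCons)
  then show ?thesis
    by (simp add: dagger_def poly_pcompose)
qed

definition unitary_rationals :: "nat \<Rightarrow> complex poly fract set" where
  "unitary_rationals n = {Fract (dagger p) p | p. p \<noteq> 0 \<and> degree p \<le> n}"

text \<open>
  Evaluation uses the irreducible form: a common zero of numerator and denominator of a
  representing quotient \<open>dagger p / p\<close> (e.g. any zero of \<open>p\<close> on the imaginary axis) is cancelled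
  before evaluating.
\<close>
definition eval_fract :: "complex poly fract \<Rightarrow> complex \<Rightarrow> complex" where
  "eval_fract r z = poly (fst (quot_of_fract r)) z / poly (snd (quot_of_fract r)) z"

definition min_degree :: "complex poly fract \<Rightarrow> nat" where
  "min_degree r =
     (LEAST m. \<exists>a b. b \<noteq> 0 \<and> degree a \<le> m \<and> degree b \<le> m \<and> r = Fract a b)"

text \<open>
  The maximum norm on the segment \<open>\<i>[-1,1]\<close>, written as a supremum. It is only applied to functions
  continuous on that segment, for which the supremum is attained.
\<close>
definition imag_norm :: "(complex \<Rightarrow> complex) \<Rightarrow> real" where
  "imag_norm f = (SUP x\<in>{-1..1::real}. cmod (f (\<i> * of_real x)))"

definition exp_error :: "real \<Rightarrow> complex poly fract \<Rightarrow> real" where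
  "exp_error \<omega> r = imag_norm (\<lambda>z. eval_fract r z - exp (of_real \<omega> * z))"

definition unitary_best_approx :: "nat \<Rightarrow> real \<Rightarrow> complex poly fract \<Rightarrow> bool" where
  "unitary_best_approx n \<omega> r \<longleftrightarrow>
     r \<in> unitary_rationals n \<and> (\<forall>u\<in>unitary_rationals n. exp_error \<omega> r \<le> exp_error \<omega> u)"

end

theory Submission
  imports Defs
begin

text \<open>
  Write \<open>\<psi>(x) = p(\<i> x) exp (\<i> \<omega> x / 2)\<close>. The error of \<open>dagger p / p\<close> at \<open>\<i> x\<close> is twice the absolute sine of
  the argument of \<open>\<psi>(x)\<close> (\<open>pointwise_error\<close>). Everything about \<open>\<omega> \<rightarrow> 0\<close> is then a matter of
  comparison with the constant \<open>1\<close>, whose error is at most \<open>\<omega>\<close>: a best approximation is within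
  \<open>\<omega>\<close> of the exponential, hence within \<open>2 \<omega>\<close> of \<open>1\<close>.

  That a best approximation has minimal degree \<open>n\<close> is the substantial claim. It rests on two facts.

  First, the best error is below \<open>2\<close> for \<open>\<omega> < (n+1) \<pi>\<close> (\<open>exists_error_less_2\<close>): \<open>n\<close> phase jumps, placed at
  the \<open>n\<close> zeros of a shifted sine, keep the argument of \<open>\<psi>\<close> strictly between \<open>-\<pi>/2\<close> and \<open>\<pi>/2\<close>.

  Secondly, a reduced quotient \<open>dagger p / p\<close> with error below \<open>2\<close> and \<open>m = degree p < n\<close> can be
  improved (\<open>degenerate_improvable\<close>). At interior points of maximal error the derivative of the
  argument of \<open>\<psi>\<close> vanishes; because \<open>\<omega> \<noteq> 0\<close>, these are zeros of a nonzero polynomial of degree at most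
  \<open>2m\<close>. With the two endpoints there are at most \<open>2m + 2\<close> extremal points. Perturbations of \<open>p\<close> in degree
  \<open>n\<close>, on the other hand, can prescribe the variation of the phase at \<open>n + m + 1\<close> points
  (\<open>prescribe_variation\<close>), which is at least \<open>2m + 2\<close>. So the error can be decreased at all extremal
  points at once.
\<close>

section \<open>The conjugation and reduced representatives\<close>

lemma dagger_eqI: "(\<And>z. poly p z = poly q z) \<Longrightarrow> p = (q :: complex poly)"
  by (simp add: poly_eq_poly_eq_iff[symmetric] fun_eq_iff)

lemma dagger_dagger [simp]: "dagger (dagger p) = p"
  by (rule dagger_eqI) (simp add: poly_dagger)

lemma dagger_mult: "dagger (p * q) = dagger p * dagger q"
  by (rule dagger_eqI) (simp add: poly_dagger)

lemma dagger_smult: "dagger (smult c p) = smult (cnj c) (dagger p)"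
  by (rule dagger_eqI) (simp add: poly_dagger)

lemma dagger_0 [simp]: "dagger 0 = 0"
  by (simp add: dagger_def)

lemma dagger_1 [simp]: "dagger 1 = 1"
  by (rule dagger_eqI) (simp add: poly_dagger)

lemma dagger_eq_0_iff [simp]: "dagger p = 0 \<longleftrightarrow> p = 0"
  by (metis dagger_0 dagger_dagger)

lemma degree_dagger [simp]: "degree (dagger p) = degree p"
  by (simp add: dagger_def degree_map_poly degree_pcompose)

lemma dagger_dvd_dagger: "p dvd q \<Longrightarrow> dagger p dvd dagger q"
  by (auto simp: dvd_def dagger_mult)

lemma poly_dagger_imag: "poly (dagger p) (\<i> * of_real x) = cnj (poly p (\<i> * of_real x))"
  by (simp add: poly_dagger)

text \<open>
  The greatest common divisor of \<open>p\<close> and \<open>dagger p\<close> is mapped by \<open>dagger\<close> to a unimodular multiple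
  \<open>cnj a\<close> of itself; after scaling by a square root of \<open>cnj a\<close> it is fixed by \<open>dagger\<close>. Dividing \<open>p\<close> by it
  therefore divides \<open>dagger p\<close> by the same polynomial, so cancelling keeps the form \<open>dagger q / q\<close>.
\<close>
lemma coprime_representative:
  assumes "p \<noteq> 0"
  obtains q where "q \<noteq> 0" "degree q \<le> degree p" "coprime (dagger q) q"
    "Fract (dagger p) p = Fract (dagger q) q"
proof -
  define g where "g = gcd p (dagger p)"
  have g0: "g \<noteq> 0" using assms by (simp add: g_def)
  have gp: "g dvd p" "g dvd dagger p" by (simp_all add: g_def)
  have "dagger g dvd g"
    using dagger_dvd_dagger[OF gp(1)] dagger_dvd_dagger[OF gp(2)]
    unfolding g_def by simp
  then obtain k where k: "g = dagger g * k" by (auto simp: dvd_def)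
  have "degree g = degree g + degree k"
    using k g0 by (metis degree_dagger degree_mult_eq mult_eq_0_iff)
  then have "degree k = 0" by simp
  then obtain a where a: "k = [:a:]" by (rule degree_eq_zeroE)
  have ga: "g = smult a (dagger g)" using k a by simp
  have "dagger g = smult (cnj a) g" using arg_cong[OF ga, of dagger] by (simp add: dagger_smult)
  then have "g = smult (a * cnj a) g" using ga by (metis smult_smult)
  then have "smult (a * cnj a - 1) g = 0" by (simp add: smult_diff_left)
  then have aa: "a * cnj a = 1" using g0 by simp
  \<comment> \<open>Rescale \<open>g\<close> so that it becomes invariant under \<open>dagger\<close>.\<close>
  define l where "l = cnj (csqrt a)"
  have ll: "l^2 = cnj a" by (simp add: l_def flip: complex_cnj_power)
  have l0: "l \<noteq> 0" using ll aa by auto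
  have "cmod a * cmod a = 1" using arg_cong[OF aa, of cmod] by (simp add: norm_mult)
  then have "cmod a = 1" by (metis abs_norm_cancel real_sqrt_abs2 real_sqrt_one)
  then have "(cmod l)\<^sup>2 = 1"
    using arg_cong[OF ll, of cmod] by (simp add: norm_power)
  then have lc: "l * cnj l = 1" using complex_norm_square[of l] by simp
  have "cnj l * cnj a = (l * cnj l) * l" by (simp only: ll[symmetric] power2_eq_square mult_ac)
  then have "cnj l * cnj a = l" using lc by simp
  then have dg: "dagger (smult l g) = smult l g"
    using \<open>dagger g = smult (cnj a) g\<close> by (simp add: dagger_smult)
  obtain q where q: "p = smult l g * q"
    using gp(1) l0 by (metis dvdE smult_dvd_iff)
  have q0: "q \<noteq> 0" using q assms by auto
  have dq: "dagger p = smult l g * dagger q" using q dg by (simp add: dagger_mult del: mult_smult_left)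
  have G0: "smult l g \<noteq> 0" using l0 g0 by simp
  have "g dvd smult l g" by (simp add: dvd_smult)
  have cop: "coprime (dagger q) q"
  proof (rule coprimeI)
    fix d assume "d dvd dagger q" "d dvd q"
    then have "smult l g * d dvd p" "smult l g * d dvd dagger p"
      using q dq by (simp_all del: mult_smult_left add: mult_dvd_mono)
    then have "smult l g * d dvd g" unfolding g_def by simp
    then have "smult l g * d dvd smult l g * 1"
      using \<open>g dvd smult l g\<close> by (metis dvd_trans mult_1_right)
    then show "is_unit d" by (simp only: dvd_times_left_cancel_iff[OF G0])
  qed
  have "Fract (dagger p) p = Fract (dagger q) q"
    using assms q0 q dq by (simp add: eq_fract mult_ac)
  moreover have "degree q \<le> degree p"
    using q G0 q0 by (metis degree_mult_eq le_add2)
  ultimately show ?thesis using that q0 cop by blast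
qed

lemma eval_fract_Fract:
  assumes "poly b z \<noteq> 0"
  shows "eval_fract (Fract a b) z = poly a z / poly b z"
proof -
  define c d where "c = fst (quot_of_fract (Fract a b))" and "d = snd (quot_of_fract (Fract a b))"
  have b0: "b \<noteq> 0" using assms by auto
  have d0: "d \<noteq> 0" by (simp add: d_def)
  have "Fract c d = Fract a b"
    by (simp add: c_def d_def Fract_quot_of_fract)
  then have e: "c * b = a * d" using b0 d0 by (simp add: eq_fract)
  have "coprime c d" unfolding c_def d_def by (rule coprime_quot_of_fract)
  then have "d dvd b" using e
    by (metis coprime_commute coprime_dvd_mult_right_iff dvd_triv_right)
  then have "poly d z \<noteq> 0" using assms by (auto elim!: dvdE)
  moreover have "poly c z * poly b z = poly a z * poly d z"
    using e by (metis poly_mult)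
  ultimately show ?thesis
    using assms by (simp add: eval_fract_def c_def[symmetric] d_def[symmetric] field_simps)
qed

text \<open>
  On the imaginary axis \<open>dagger p\<close> is the conjugate of \<open>p\<close>, so a zero of \<open>p\<close> there is a common zero.
\<close>
lemma coprime_dagger_imp_poly_imag_nonzero:
  assumes "coprime (dagger p) p"
  shows "poly p (\<i> * of_real x) \<noteq> 0"
proof
  assume z: "poly p (\<i> * of_real x) = 0"
  then have "poly (dagger p) (\<i> * of_real x) = 0" by (simp add: poly_dagger_imag)
  with z have "[:- (\<i> * of_real x), 1:] dvd p" "[:- (\<i> * of_real x), 1:] dvd dagger p"
    by (simp_all only: poly_eq_0_iff_dvd)
  then have "is_unit [:- (\<i> * of_real x), 1:]" using assms coprime_common_divisor by blast
  then show False by (simp add: is_unit_poly_iff)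
qed

section \<open>The error as a sine of the phase\<close>

text \<open>
  Since \<open>dagger p / p\<close> is \<open>cnj P / P\<close> at \<open>\<i> x\<close>, where \<open>P = poly p (\<i> x)\<close>, its argument is minus
  twice that of \<open>P\<close>. The argument of the value below is minus half of the phase error.
\<close>
definition phased :: "real \<Rightarrow> complex poly \<Rightarrow> real \<Rightarrow> complex" where
  "phased \<omega> p x = poly p (\<i> * of_real x) * cis (\<omega> / 2 * x)"

text \<open>
  Multiplying by the unimodular \<open>cnj e\<close>, with \<open>e = cis (\<omega> x / 2)\<close>, turns \<open>cnj P / P - e\<^sup>2\<close> into
  \<open>(cnj (P e) - P e) / P\<close>. The error is thus twice the absolute sine of the argument of \<open>P e\<close>.
\<close>
lemma pointwise_error:
  assumes "poly p (\<i> * of_real x) \<noteq> 0"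
  shows "cmod (eval_fract (Fract (dagger p) p) (\<i> * of_real x) - exp (of_real \<omega> * (\<i> * of_real x)))
       = 2 * \<bar>Im (phased \<omega> p x)\<bar> / cmod (phased \<omega> p x)"
proof -
  define P e where "P = poly p (\<i> * of_real x)" and "e = cis (\<omega> / 2 * x)"
  have ee: "exp (of_real \<omega> * (\<i> * of_real x)) = e * e"
  proof -
    have "e * e = cis (\<omega> * x)" by (simp add: e_def cis_mult)
    then show ?thesis by (simp add: cis_conv_exp mult_ac)
  qed
  have ce: "cnj e * e = 1" by (simp add: e_def cis_cnj cis_mult)
  have ne: "cmod (cnj e) = 1" "cmod e = 1" by (simp_all add: e_def)
  have "cmod (cnj P / P - e * e) = cmod (cnj e * (cnj P / P - e * e))"
    using ne by (simp add: norm_mult)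
  also have "cnj e * (cnj P / P - e * e) = (cnj (P * e) - P * e) / P"
    using assms ce by (simp add: P_def field_simps)
  also have "cnj (P * e) - P * e = - (2 * \<i> * of_real (Im (P * e)))"
    by (simp add: complex_eq_iff)
  finally have "cmod (cnj P / P - e * e) = 2 * \<bar>Im (P * e)\<bar> / cmod (P * e)"
    by (simp only: norm_mult norm_divide norm_minus_cancel norm_of_real ne) simp
  then show ?thesis
    using assms by (simp only: eval_fract_Fract phased_def P_def e_def ee poly_dagger_imag not_False_eq_True)
qed

lemma continuous_on_phased [continuous_intros]: "continuous_on S (phased \<omega> p)"
  unfolding phased_def by (intro continuous_intros)

lemma
  assumes "\<And>x. x \<in> {-1..1} \<Longrightarrow> poly p (\<i> * of_real x) \<noteq> 0"
  shows exp_error_upper: "\<And>x. x \<in> {-1..1} \<Longrightarrow>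
      2 * \<bar>Im (phased \<omega> p x)\<bar> / cmod (phased \<omega> p x) \<le> exp_error \<omega> (Fract (dagger p) p)"
    and exp_error_max: "\<exists>x\<in>{-1..1}.
      exp_error \<omega> (Fract (dagger p) p) = 2 * \<bar>Im (phased \<omega> p x)\<bar> / cmod (phased \<omega> p x)"
proof -
  let ?f = "\<lambda>x. 2 * \<bar>Im (phased \<omega> p x)\<bar> / cmod (phased \<omega> p x)"
  have nz: "phased \<omega> p x \<noteq> 0" if "x \<in> {-1..1}" for x
    using assms[OF that] by (simp add: phased_def)
  have err: "exp_error \<omega> (Fract (dagger p) p) = (SUP x\<in>{-1..1}. ?f x)"
    unfolding exp_error_def imag_norm_def
    by (intro SUP_cong refl pointwise_error assms)
  have "continuous_on {-1..1} ?f"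
    using nz by (intro continuous_intros) auto
  then obtain x where x: "x \<in> {-1..1}" "\<And>y. y \<in> {-1..1} \<Longrightarrow> ?f y \<le> ?f x"
    using continuous_attains_sup[of "{-1..1::real}" ?f] by auto
  have "(SUP x\<in>{-1..1}. ?f x) = ?f x"
    using x by (intro cSup_eq_maximum) auto
  with err have E: "exp_error \<omega> (Fract (dagger p) p) = ?f x" by simp
  show "\<And>x. x \<in> {-1..1} \<Longrightarrow> ?f x \<le> exp_error \<omega> (Fract (dagger p) p)"
    unfolding E by (rule x(2))
  show "\<exists>x\<in>{-1..1}. exp_error \<omega> (Fract (dagger p) p) = ?f x" using E x(1) by blast
qed

section \<open>Interpolation and uniform descent\<close>

lemma interpolation:
  fixes f :: "'a::field \<Rightarrow> 'a"
  assumes "finite S"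
  shows "\<exists>p. degree p \<le> card S - 1 \<and> (\<forall>x\<in>S. poly p x = f x)"
  using assms
proof (induction S)
  case empty
  then show ?case by (intro exI[of _ 0]) auto
next
  case (insert x S)
  then obtain p where p: "degree p \<le> card S - 1" "\<forall>y\<in>S. poly p y = f y" by blast
  define w where "w = (\<Prod>y\<in>S. [:-y, 1:])"
  have w0: "poly w x \<noteq> 0" using insert(1,2) by (auto simp: w_def poly_prod)
  have ws: "poly w y = 0" if "y \<in> S" for y
    using insert(1) that by (auto simp: w_def poly_prod)
  have "degree w \<le> card S"
    unfolding w_def using degree_prod_sum_le[OF insert(1), of "\<lambda>y. [:-y, 1:]"] by simp
  then have "degree (p + smult ((f x - poly p x) / poly w x) w) \<le> card S"
    using p(1) by (intro degree_add_le) auto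
  moreover have "\<forall>y\<in>insert x S. poly (p + smult ((f x - poly p x) / poly w x) w) y = f y"
    using p(2) w0 ws by auto
  ultimately show ?case using insert by (metis card_insert_disjoint diff_Suc_1)
qed

text \<open>
  At every point of \<open>K\<close> either \<open>a\<close> or \<open>b\<close> is negative, so by compactness the minimum of the two is
  bounded away from \<open>0\<close>. Where \<open>a\<close> is negative, a small \<open>t\<close> does no harm; elsewhere the first-order
  term dominates the quadratic one. This turns first-order information at the points where \<open>a\<close>
  vanishes into strict inequality everywhere.
\<close>
lemma uniform_descent:
  fixes a b c :: "'x::topological_space \<Rightarrow> real"
  assumes K: "compact K"
    and cont: "continuous_on K a" "continuous_on K b" "continuous_on K c"
    and a: "\<And>x. x \<in> K \<Longrightarrow> a x \<le> 0"
    and b: "\<And>x. x \<in> K \<Longrightarrow> a x = 0 \<Longrightarrow> b x < 0"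
  shows "\<exists>t>0. \<forall>x\<in>K. a x + t * b x + t\<^sup>2 * c x < 0"
proof (cases "K = {}")
  case True
  then show ?thesis by (intro exI[of _ 1]) auto
next
  case False
  have "continuous_on K (\<lambda>x. min (a x) (b x))" using cont by (intro continuous_intros)
  then obtain x0 where x0: "x0 \<in> K" "\<And>x. x \<in> K \<Longrightarrow> min (a x) (b x) \<le> min (a x0) (b x0)"
    using continuous_attains_sup[OF K False] by blast
  define \<delta> where "\<delta> = - min (a x0) (b x0)"
  have \<delta>: "\<delta> > 0" using a[OF x0(1)] b[OF x0(1)]
    by (cases "a x0 = 0") (auto simp: \<delta>_def min_less_iff_disj less_le)
  have "bounded (b ` K)" "bounded (c ` K)"
    using compact_continuous_image[OF _ K] cont compact_imp_bounded by blast+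
  then obtain B C where BC: "\<forall>x\<in>K. \<bar>b x\<bar> \<le> B" "\<forall>x\<in>K. \<bar>c x\<bar> \<le> C"
    unfolding bounded_iff by (auto simp: )
  define D where "D = max 1 (max B C)"
  have D: "D > 0" "\<And>x. x \<in> K \<Longrightarrow> b x \<le> D" "\<And>x. x \<in> K \<Longrightarrow> c x \<le> D"
    using BC by (force simp: D_def le_max_iff_disj)+
  define t where "t = min 1 (\<delta> / (4 * D))"
  have t: "t > 0" "t \<le> 1" using \<delta> D by (auto simp: t_def)
  have "t \<le> \<delta> / (4 * D)" by (simp add: t_def)
  then have tD: "4 * (t * D) \<le> \<delta>" using D(1) by (simp add: field_simps)
  have "a x + t * b x + t\<^sup>2 * c x < 0" if x: "x \<in> K" for x
  proof -
    have tb: "t * b x \<le> t * D" using D(2)[OF x] t by simp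
    have tc: "t * c x \<le> t * D" using D(3)[OF x] t by simp
    have ttc: "t\<^sup>2 * c x \<le> t * (t * D)"
      using tc t by (simp add: power2_eq_square mult.assoc)
    consider "a x \<le> - \<delta>" | "b x \<le> - \<delta>"
      using x0(2)[OF x] by (auto simp: \<delta>_def min_def split: if_splits)
    then show ?thesis
    proof cases
      case 1
      have "t * (t * D) \<le> 1 * (t * D)" using t D(1) by (intro mult_right_mono) auto
      with 1 tb ttc tD \<delta> show ?thesis by linarith
    next
      case 2
      have "b x + t * D < 0" using 2 tD \<delta> D(1) t(1) by (smt (verit) mult_pos_pos)
      then have "t * (b x + t * D) < 0" using t(1) by (simp add: mult_pos_neg)
      then show ?thesis using a[OF x] ttc by (simp add: distrib_left)
    qed
  qed
  with t(1) show ?thesis by blast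
qed

section \<open>Approximations with error below two\<close>

text \<open>
  The product changes sign at \<open>\<pi>, ..., n \<pi>\<close>, exactly where the sine does on this interval. In the
  induction, shifting \<open>v\<close> by \<open>\<pi>\<close> flips the sign of the sine and of the split-off factor alike.
\<close>
lemma sin_times_prod_nonneg:
  assumes "0 \<le> v" "v \<le> (real n + 1) * pi"
  shows "0 \<le> sin v * (\<Prod>j<n. (real (Suc j) * pi - v))"
  using assms
proof (induction n arbitrary: v)
  case 0
  then show ?case by (simp add: sin_ge_zero)
next
  case (Suc n)
  have eq: "(\<Prod>j<Suc n. (real (Suc j) * pi - v)) = (pi - v) * (\<Prod>j<n. (real (Suc j) * pi - (v - pi)))"
    by (subst prod.lessThan_Suc_shift) (simp add: algebra_simps)
  show ?case
  proof (cases "v \<le> pi")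
    case True
    have "0 \<le> real (Suc j) * pi - v" for j
    proof -
      have "real (Suc j) * pi = pi + real j * pi" by (simp add: distrib_right)
      moreover have "0 \<le> real j * pi" by simp
      ultimately show ?thesis using True by linarith
    qed
    then show ?thesis using True Suc.prems
      by (intro mult_nonneg_nonneg sin_ge_zero prod_nonneg) auto
  next
    case False
    have "0 \<le> sin (v - pi) * (\<Prod>j<n. (real (Suc j) * pi - (v - pi)))"
      using False Suc.prems by (intro Suc.IH) (auto simp: algebra_simps)
    then have "0 \<le> (v - pi) * (sin (v - pi) * (\<Prod>j<n. (real (Suc j) * pi - (v - pi))))"
      using False by (intro mult_nonneg_nonneg[of "v - pi"]) simp_all
    also have "\<dots> = sin v * (\<Prod>j<Suc n. (real (Suc j) * pi - v))"
      unfolding eq by (simp add: sin_diff algebra_simps)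
    finally show ?thesis .
  qed
qed

lemma sin_times_prod_eq_0:
  assumes "0 < v" "v < (real n + 1) * pi" "sin v * (\<Prod>j<n. (real (Suc j) * pi - v)) = 0"
  shows "\<exists>j<n. v = real (Suc j) * pi"
proof (cases "sin v = 0")
  case True
  then obtain k :: int where k: "v = of_int k * pi" by (auto simp: sin_zero_iff_int2)
  have "0 < k" "of_int k < real n + 1" using assms(1,2) k by (auto simp: zero_less_mult_iff)
  then have "k < int n + 1" by linarith
  then have "nat k - 1 < n" "v = real (Suc (nat k - 1)) * pi" using \<open>0 < k\<close> k by auto
  then show ?thesis by blast
next
  case False
  with assms(3) show ?thesis by auto
qed

text \<open>
  Both conditions compare the sines of the arguments; the right one does so through squared
  tangents. It is quadratic in real and imaginary parts, so it behaves well under perturbation.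
\<close>
lemma sine_quotient_le_iff:
  assumes "w \<noteq> 0" "z \<noteq> 0"
  shows "\<bar>Im w\<bar> / cmod w \<le> \<bar>Im z\<bar> / cmod z \<longleftrightarrow> (Im w)\<^sup>2 * (Re z)\<^sup>2 \<le> (Im z)\<^sup>2 * (Re w)\<^sup>2"
proof -
  have "\<bar>Im w\<bar> / cmod w \<le> \<bar>Im z\<bar> / cmod z \<longleftrightarrow> \<bar>Im w\<bar> * cmod z \<le> \<bar>Im z\<bar> * cmod w"
    using assms by (simp add: field_simps)
  also have "\<dots> \<longleftrightarrow> (\<bar>Im w\<bar> * cmod z)\<^sup>2 \<le> (\<bar>Im z\<bar> * cmod w)\<^sup>2"
    by (simp add: power_mono_iff)
  also have "\<dots> \<longleftrightarrow> (Im w)\<^sup>2 * (Re z)\<^sup>2 \<le> (Im z)\<^sup>2 * (Re w)\<^sup>2"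
    by (simp add: power_mult_distrib cmod_power2 algebra_simps)
  finally show ?thesis .
qed

lemma phased_add_smult: "phased \<omega> (p + smult (of_real t) q) x = phased \<omega> p x + t *\<^sub>R phased \<omega> q x"
  by (simp add: phased_def algebra_simps scaleR_conv_of_real)

lemma cis_factor_cancel: "(a * cis t) * cnj (b * cis t) = a * cnj b"
proof -
  have "(a * cis t) * cnj (b * cis t) = a * cnj b * (cis t * cnj (cis t))"
    by (simp only: complex_cnj_mult mult_ac)
  then show ?thesis by (simp add: cis_cnj cis_mult)
qed

lemma phased_cnj_phased:
  "phased \<omega> q x * cnj (phased \<omega> p x) = poly q (\<i> * of_real x) * cnj (poly p (\<i> * of_real x))"
  unfolding phased_def by (rule cis_factor_cancel)

lemma phased_eq_0_iff: "phased \<omega> p x = 0 \<longleftrightarrow> poly p (\<i> * of_real x) = 0"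
  by (simp add: phased_def)

text \<open>
  The error \<open>2\<close> is the one at phase error \<open>\<pi>\<close>, where the phased value is purely imaginary.
\<close>
lemma exp_error_less_2:
  assumes "\<And>x. x \<in> {-1..1} \<Longrightarrow> Re (phased \<omega> p x) \<noteq> 0"
  shows "exp_error \<omega> (Fract (dagger p) p) < 2"
proof -
  have "poly p (\<i> * of_real x) \<noteq> 0" if "x \<in> {-1..1}" for x
    using assms[OF that] by (auto simp: phased_def)
  then obtain x where x: "x \<in> {-1..1}"
    "exp_error \<omega> (Fract (dagger p) p) = 2 * \<bar>Im (phased \<omega> p x)\<bar> / cmod (phased \<omega> p x)"
    using exp_error_max by blast
  have re: "Re (phased \<omega> p x) \<noteq> 0" by (rule assms[OF x(1)])
  then have "\<bar>Im (phased \<omega> p x)\<bar>\<^sup>2 < (cmod (phased \<omega> p x))\<^sup>2"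
    by (simp add: cmod_power2)
  then have "\<bar>Im (phased \<omega> p x)\<bar> < cmod (phased \<omega> p x)"
    by (rule power2_less_imp_less) simp
  moreover have "0 < cmod (phased \<omega> p x)" using re by auto
  ultimately show ?thesis unfolding x(2) by (simp add: divide_less_eq)
qed

text \<open>
  A polynomial with real part of \<open>phased\<close> positive on \<open>[-1,1]\<close> is needed. Put \<open>v = \<omega> x / 2 + (n+1) \<pi> / 2\<close>,
  which stays strictly between \<open>0\<close> and \<open>(n+1) \<pi>\<close>; this is where the bound on \<open>\<omega>\<close> enters. The product
  of the \<open>n\<close> real linear factors \<open>j \<pi> - v\<close>, multiplied by a suitable unimodular constant, has real part
  \<open>sin v\<close> times that product, which is nonnegative and vanishes only at the \<open>n\<close> zeros of the factors.
  Adding a small multiple of a polynomial whose phased value is \<open>1\<close> at these zeros makes it positive.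
\<close>
lemma exists_error_less_2:
  assumes "0 < \<omega>" "\<omega> < (real n + 1) * pi"
  shows "\<exists>u\<in>unitary_rationals n. exp_error \<omega> u < 2"
proof -
  define h where "h = (real n + 1) * pi / 2"
  define c where "c = \<omega> / 2"
  have c: "0 < c" "c < h" using assms by (simp_all add: c_def h_def)
  define v where "v x = c * x + h" for x
  have v: "0 < v x" "v x < (real n + 1) * pi" if "x \<in> {-1..1}" for x
  proof -
    have "\<bar>c * x\<bar> \<le> c * 1" using that c(1) unfolding abs_mult by (intro mult_mono) auto
    then show "0 < v x" "v x < (real n + 1) * pi" using c(2) by (auto simp: v_def h_def)
  qed
  define A where "A = (\<Prod>j<n. [: of_real (real (Suc j) * pi - h), \<i> * of_real c :])"
  have A: "poly A (\<i> * of_real x) = of_real (\<Prod>j<n. (real (Suc j) * pi - v x))" for x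
    by (simp add: A_def poly_prod v_def algebra_simps)
  have "degree A \<le> n"
    unfolding A_def using degree_prod_sum_le[of "{..<n}" "\<lambda>j. [: of_real (real (Suc j) * pi - h), \<i> * of_real c :]"] c
    by simp
  define p where "p = smult (- \<i> * cis h) A"
  have p: "Re (phased \<omega> p x) = sin (v x) * (\<Prod>j<n. (real (Suc j) * pi - v x))" for x
  proof -
    have "phased \<omega> p x = - \<i> * (cis h * cis (c * x)) * of_real (\<Prod>j<n. (real (Suc j) * pi - v x))"
      by (simp add: phased_def p_def A c_def mult_ac)
    also have "cis h * cis (c * x) = cis (v x)" by (simp add: cis_mult v_def add_ac)
    finally show ?thesis by (simp only: Re_complex_of_real Im_complex_of_real times_complex.sel) simp
  qed
  define S where "S = (\<lambda>j. \<i> * of_real ((real (Suc j) * pi - h) / c) :: complex) ` {..<n}"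
  have finS: "finite S" by (simp add: S_def)
  have "card S \<le> n" using card_image_le[of "{..<n}"] by (simp add: S_def)
  moreover obtain q where q: "degree q \<le> card S - 1" "\<And>z. z \<in> S \<Longrightarrow> poly q z = exp (- of_real c * z)"
    using interpolation[of S "\<lambda>z. exp (- of_real c * z)"] finS by blast
  ultimately have dq: "degree q \<le> n" by linarith
  have q1: "phased \<omega> q x = 1" if "\<i> * of_real x \<in> S" for x
    using q(2)[OF that] by (simp add: phased_def cis_conv_exp c_def mult_ac flip: exp_add)
  have "\<exists>t>0. \<forall>x\<in>{-1..1}. - Re (phased \<omega> p x) + t * (- Re (phased \<omega> q x)) + t\<^sup>2 * 0 < 0"
  proof (rule uniform_descent)
    fix x :: real assume x: "x \<in> {-1..1}"
    show "- Re (phased \<omega> p x) \<le> 0"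
      using sin_times_prod_nonneg[of "v x" n] v[OF x] p by simp
    assume "- Re (phased \<omega> p x) = 0"
    then obtain j where "j < n" "v x = real (Suc j) * pi"
      using sin_times_prod_eq_0[OF v[OF x]] p by auto
    then have "x = (real (Suc j) * pi - h) / c" using c(1) by (simp add: v_def field_simps)
    then have "\<i> * of_real x \<in> S" using \<open>j < n\<close> by (auto simp: S_def)
    then show "- Re (phased \<omega> q x) < 0" by (simp add: q1)
  qed (auto intro!: continuous_intros)
  then obtain t where "\<forall>x\<in>{-1..1}. - Re (phased \<omega> p x) + t * (- Re (phased \<omega> q x)) + t\<^sup>2 * 0 < 0"
    by blast
  then have t: "Re (phased \<omega> (p + smult (of_real t) q) x) > 0" if "x \<in> {-1..1}" for x
    unfolding phased_add_smult using that by fastforce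
  define u where "u = p + smult (of_real t) q"
  have "degree u \<le> n" unfolding u_def p_def using dq \<open>degree A \<le> n\<close>
    by (intro degree_add_le) (meson degree_smult_le order_trans)+
  moreover have "u \<noteq> 0" using t[of 0] by (auto simp: u_def[symmetric] phased_def)
  ultimately have "Fract (dagger u) u \<in> unitary_rationals n" by (auto simp: unitary_rationals_def)
  moreover have "exp_error \<omega> (Fract (dagger u) u) < 2"
    using t by (intro exp_error_less_2) (force simp: u_def)
  ultimately show ?thesis by blast
qed

section \<open>Degenerate approximations are not optimal\<close>

lemma phased_derivative:
  "(phased \<omega> p has_vector_derivative
     (\<i> * poly (pderiv p) (\<i> * of_real x) + \<i> * of_real (\<omega> / 2) * poly p (\<i> * of_real x)) * cis (\<omega> / 2 * x)) (at x)"
proof -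
  have eq: "phased \<omega> p = (\<lambda>x. (\<lambda>z. poly p (\<i> * z) * exp (\<i> * of_real (\<omega> / 2) * z)) (of_real x))"
    by (simp add: phased_def fun_eq_iff cis_conv_exp mult_ac)
  show ?thesis unfolding eq
    by (rule has_vector_derivative_real_field)
      (auto intro!: derivative_eq_intros poly_DERIV[THEN DERIV_chain2] simp: cis_conv_exp algebra_simps)
qed

text \<open>
  At \<open>\<i> x\<close> this is the imaginary part of \<open>\<psi>' cnj \<psi>\<close> for \<open>\<psi> = phased \<omega> p\<close>, that is, \<open>\<bar>\<psi>\<bar>\<^sup>2\<close> times the derivative
  of the argument of \<open>\<psi>\<close>.
\<close>
definition stationary_poly :: "real \<Rightarrow> complex poly \<Rightarrow> complex poly" where
  "stationary_poly \<omega> p = smult (1/2) (pderiv p * dagger p + p * dagger (pderiv p))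
     + smult (of_real (\<omega> / 2)) (p * dagger p)"

text \<open>
  The summand \<open>(\<omega> / 2) p dagger p\<close> has degree \<open>2 degree p\<close> and cannot be cancelled by the others, which
  contain a derivative of \<open>p\<close> and vanish or have smaller degree.
\<close>
lemma stationary_poly:
  assumes "0 < \<omega>" "p \<noteq> 0"
  shows "stationary_poly \<omega> p \<noteq> 0" and "degree (stationary_poly \<omega> p) \<le> 2 * degree p"
proof -
  let ?s = "pderiv p * dagger p + p * dagger (pderiv p)"
  have d: "degree (p * dagger p) = 2 * degree p"
    using assms by (simp add: degree_mult_eq)
  have s: "degree ?s \<le> 2 * degree p - 1"
  proof (rule degree_add_le)
    show "degree (pderiv p * dagger p) \<le> 2 * degree p - 1"
      using degree_mult_le[of "pderiv p" "dagger p"] by (cases "degree p = 0") (auto simp: degree_pderiv pderiv_eq_0_iff)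
    show "degree (p * dagger (pderiv p)) \<le> 2 * degree p - 1"
      using degree_mult_le[of p "dagger (pderiv p)"] by (cases "degree p = 0") (auto simp: degree_pderiv pderiv_eq_0_iff)
  qed
  show "degree (stationary_poly \<omega> p) \<le> 2 * degree p"
    unfolding stationary_poly_def
  proof (rule degree_add_le)
    show "degree (smult (1/2) ?s) \<le> 2 * degree p"
      using degree_smult_le[of "1/2" ?s] s by linarith
    show "degree (smult (of_real (\<omega> / 2)) (p * dagger p)) \<le> 2 * degree p"
      using degree_smult_le[of "of_real (\<omega> / 2)" "p * dagger p"] d by linarith
  qed
  show "stationary_poly \<omega> p \<noteq> 0"
  proof
    assume z: "stationary_poly \<omega> p = 0"
    have "coeff (stationary_poly \<omega> p) (2 * degree p) = of_real (\<omega> / 2) * lead_coeff (p * dagger p)"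
    proof (cases "degree p = 0")
      case True
      then have "pderiv p = 0" by (simp add: pderiv_eq_0_iff)
      then show ?thesis unfolding stationary_poly_def using d by simp
    next
      case False
      then have "coeff ?s (2 * degree p) = 0" using s by (intro coeff_eq_0) linarith
      then show ?thesis unfolding stationary_poly_def using d by simp
    qed
    then show False using z assms by simp
  qed
qed

text \<open>
  The hypothesis says that the tangent of the argument of \<open>phased\<close> has a maximal absolute value at \<open>x\<close>.
  As the real part has no zeros, the tangent is differentiable, so its derivative vanishes at \<open>x\<close>.
\<close>
lemma stationary_point:
  assumes re: "\<And>y. y \<in> {-1..1} \<Longrightarrow> Re (phased \<omega> p y) \<noteq> 0"
    and x: "-1 < x" "x < 1"
    and ext: "\<And>y. y \<in> {-1..1} \<Longrightarrow>
      (Im (phased \<omega> p y))\<^sup>2 * (Re (phased \<omega> p x))\<^sup>2 \<le> (Im (phased \<omega> p x))\<^sup>2 * (Re (phased \<omega> p y))\<^sup>2"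
  shows "poly (stationary_poly \<omega> p) (\<i> * of_real x) = 0"
proof -
  let ?\<psi> = "phased \<omega> p"
  define P D where "P = poly p (\<i> * of_real x)" and "D = poly (pderiv p) (\<i> * of_real x)"
  define d where "d = (\<i> * D + \<i> * of_real (\<omega> / 2) * P) * cis (\<omega> / 2 * x)"
  have d: "(?\<psi> has_vector_derivative d) (at x)"
    unfolding d_def D_def P_def by (rule phased_derivative)
  have I: "((\<lambda>y. Im (?\<psi> y)) has_real_derivative Im d) (at x)"
    using bounded_linear.has_vector_derivative[OF bounded_linear_Im d]
    by (simp add: has_real_derivative_iff_has_vector_derivative)
  have R: "((\<lambda>y. Re (?\<psi> y)) has_real_derivative Re d) (at x)"
    using bounded_linear.has_vector_derivative[OF bounded_linear_Re d]
    by (simp add: has_real_derivative_iff_has_vector_derivative)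
  have rx: "Re (?\<psi> x) \<noteq> 0" using re x by simp
  define k where "k y = Im (?\<psi> y) / Re (?\<psi> y)" for y
  define l where "l = (Im d * Re (?\<psi> x) - Im (?\<psi> x) * Re d) / (Re (?\<psi> x) * Re (?\<psi> x))"
  have k: "(k has_real_derivative l) (at x)"
    unfolding k_def l_def by (rule DERIV_divide[OF I R rx])
  have kb: "\<bar>k y\<bar> \<le> \<bar>k x\<bar>" if "y \<in> {-1..1}" for y
  proof -
    have "(k y)\<^sup>2 \<le> (k x)\<^sup>2"
      using ext[OF that] re[OF that] rx by (simp add: k_def power_divide field_simps)
    then show ?thesis by (simp add: abs_le_square_iff)
  qed
  define r where "r = min (1 - x) (1 + x)"
  have r: "r > 0" using x by (simp add: r_def)
  have near: "y \<in> {-1..1}" if "\<bar>x - y\<bar> < r" for y using that by (auto simp: r_def)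
  have "l = 0"
  proof (cases "k x \<ge> 0")
    case True
    then have "\<forall>y. \<bar>x - y\<bar> < r \<longrightarrow> k y \<le> k x" using kb near by force
    then show ?thesis using DERIV_local_max[OF k r] by blast
  next
    case False
    then have "\<forall>y. \<bar>x - y\<bar> < r \<longrightarrow> k x \<le> k y" using kb near by force
    then show ?thesis using DERIV_local_min[OF k r] by blast
  qed
  then have "Im (d * cnj (?\<psi> x)) = 0" using rx by (simp add: l_def algebra_simps)
  moreover have "d * cnj (?\<psi> x) = (\<i> * D + \<i> * of_real (\<omega> / 2) * P) * cnj P"
    unfolding d_def phased_def P_def by (rule cis_factor_cancel)
  moreover have "poly (stationary_poly \<omega> p) (\<i> * of_real x)
      = of_real (Im ((\<i> * D + \<i> * of_real (\<omega> / 2) * P) * cnj P))"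
    by (simp add: stationary_poly_def poly_dagger_imag D_def[symmetric] P_def[symmetric]
      complex_eq_iff algebra_simps add_divide_distrib diff_divide_distrib)
  ultimately show ?thesis by simp
qed

text \<open>
  For a perturbation \<open>q\<close> of \<open>p\<close>, the quantity prescribed here is the first-order change of the argument
  of \<open>p\<close>, scaled by \<open>\<bar>p\<bar>\<^sup>2\<close>. Any polynomial \<open>N\<close> of degree at most \<open>n + degree p\<close> is
  \<open>A dagger p + B p\<close> with \<open>A\<close> and \<open>B\<close> of degree at most \<open>n\<close>, by coprimality; for \<open>q = A - dagger B\<close> the
  variation on the imaginary axis is \<open>Im N\<close>. So \<open>n + degree p + 1\<close> values can be interpolated.
\<close>
lemma prescribe_variation:
  fixes g :: "real \<Rightarrow> real"
  assumes cop: "coprime (dagger p) p" and p: "p \<noteq> 0" "degree p \<le> n"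
    and S: "finite S" "card S \<le> n + degree p + 1"
  obtains q where "degree q \<le> n"
    "\<And>x. x \<in> S \<Longrightarrow> Im (poly q (\<i> * of_real x) * cnj (poly p (\<i> * of_real x))) = g x"
proof -
  define T where "T = (\<lambda>x. \<i> * complex_of_real x) ` S"
  have "card T \<le> n + degree p + 1" using card_image_le[OF S(1)] S(2) unfolding T_def by (meson order_trans)
  moreover obtain N where N: "degree N \<le> card T - 1" "\<And>z. z \<in> T \<Longrightarrow> poly N z = \<i> * of_real (g (Im z))"
    using interpolation[of T "\<lambda>z. \<i> * of_real (g (Im z))"] S(1) unfolding T_def by blast
  ultimately have dN: "degree N \<le> n + degree p" by linarith
  define a b where "a = fst (bezout_coefficients (dagger p) p)" and "b = snd (bezout_coefficients (dagger p) p)"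
  have ab: "a * dagger p + b * p = 1"
    using bezout_coefficients_fst_snd[of "dagger p" p] cop by (simp add: a_def b_def)
  define A B where "A = (N * a) mod p" and "B = N * b + (N * a) div p * dagger p"
  have eq: "A * dagger p + B * p = N"
  proof -
    have "A * dagger p + B * p = ((N * a) mod p + (N * a) div p * p) * dagger p + N * b * p"
      unfolding A_def B_def by (simp only: distrib_left distrib_right mult_ac add_ac)
    also have "\<dots> = N * (a * dagger p + b * p)"
      by (simp only: mod_div_mult_eq) (simp add: algebra_simps)
    finally show ?thesis using ab by simp
  qed
  have dA: "degree A \<le> degree p"
    using degree_mod_less[of p "N * a"] p by (auto simp: A_def)
  have dB: "degree B \<le> n"
  proof (cases "B = 0")
    case False
    have "degree (B * p) \<le> n + degree p"
    proof -
      have "B * p = N - A * dagger p" using eq by (simp add: algebra_simps)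
      moreover have "degree (A * dagger p) \<le> n + degree p"
        using degree_mult_le[of A "dagger p"] dA p(2) by simp
      ultimately show ?thesis using dN by (simp add: degree_diff_le)
    qed
    then show ?thesis using False p(1) by (simp add: degree_mult_eq)
  qed simp
  show ?thesis
  proof
    show "degree (A - dagger B) \<le> n" using dA dB p(2) by (simp add: degree_diff_le)
    fix x assume "x \<in> S"
    let ?z = "\<i> * complex_of_real x"
    have "Im (poly (A - dagger B) ?z * cnj (poly p ?z)) = Im (poly (A * dagger p + B * p) ?z)"
      by (simp add: poly_dagger_imag algebra_simps)
    also have "\<dots> = g x" using N(2)[of ?z] \<open>x \<in> S\<close> by (simp add: eq T_def)
    finally show "Im (poly (A - dagger B) ?z * cnj (poly p ?z)) = g x" .
  qed
qed

text \<open>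
  The points \<open>X\<close> of maximal error are among \<open>-1\<close>, \<open>1\<close> and the zeros of \<open>stationary_poly\<close>, so there
  are at most \<open>2 degree p + 2\<close> of them. If \<open>degree p < n\<close> this does not exceed \<open>n + degree p + 1\<close>, and a
  perturbation \<open>q\<close> can be chosen that decreases the error to first order at all of them at once.
  \<open>uniform_descent\<close> then yields a smaller error on the whole segment.
\<close>
lemma degenerate_improvable:
  assumes cop: "coprime (dagger p) p" and p: "p \<noteq> 0" "degree p < n"
    and \<omega>: "0 < \<omega>" and less2: "exp_error \<omega> (Fract (dagger p) p) < 2"
  shows "\<exists>u\<in>unitary_rationals n. exp_error \<omega> u < exp_error \<omega> (Fract (dagger p) p)"
proof -
  let ?I = "{-1..1::real}"
  let ?\<psi> = "phased \<omega> p"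
  have nz: "poly p (\<i> * of_real x) \<noteq> 0" for x
    by (rule coprime_dagger_imp_poly_imag_nonzero[OF cop])
  have \<psi>nz: "?\<psi> x \<noteq> 0" for x using nz by (simp add: phased_eq_0_iff)
  obtain x0 where x0: "x0 \<in> ?I"
    and E: "exp_error \<omega> (Fract (dagger p) p) = 2 * \<bar>Im (?\<psi> x0)\<bar> / cmod (?\<psi> x0)"
    using exp_error_max[of p \<omega>] nz by blast
  define \<alpha> \<beta> where "\<alpha> = (Im (?\<psi> x0))\<^sup>2" and "\<beta> = (Re (?\<psi> x0))\<^sup>2"
  have le: "(Im (?\<psi> y))\<^sup>2 * \<beta> \<le> \<alpha> * (Re (?\<psi> y))\<^sup>2" if "y \<in> ?I" for y
  proof -
    have "2 * \<bar>Im (?\<psi> y)\<bar> / cmod (?\<psi> y) \<le> 2 * \<bar>Im (?\<psi> x0)\<bar> / cmod (?\<psi> x0)"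
      using exp_error_upper[of p y \<omega>] nz that E by simp
    then show ?thesis unfolding \<alpha>_def \<beta>_def
      using sine_quotient_le_iff[OF \<psi>nz \<psi>nz, of y x0] by simp
  qed
  \<comment> \<open>A purely imaginary phased value would give the error \<open>2\<close>.\<close>
  have "\<beta> \<noteq> 0"
  proof
    assume "\<beta> = 0"
    then have "\<bar>Im (?\<psi> x0)\<bar> = cmod (?\<psi> x0)" by (simp add: \<beta>_def cmod_def)
    then show False using less2 E \<psi>nz by simp
  qed
  then have \<beta>: "\<beta> > 0" by (simp add: \<beta>_def)
  have re: "Re (?\<psi> y) \<noteq> 0" if "y \<in> ?I" for y
  proof
    assume z: "Re (?\<psi> y) = 0"
    then have "Im (?\<psi> y) = 0" using le[OF that] \<beta> by (simp add: mult_le_0_iff)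
    with z show False using \<psi>nz[of y] by (simp add: complex_eq_iff)
  qed
  define X where "X = {x \<in> ?I. (Im (?\<psi> x))\<^sup>2 * \<beta> = \<alpha> * (Re (?\<psi> x))\<^sup>2}"
  have ext: "(Im (?\<psi> y))\<^sup>2 * (Re (?\<psi> x))\<^sup>2 \<le> (Im (?\<psi> x))\<^sup>2 * (Re (?\<psi> y))\<^sup>2"
    if x: "x \<in> X" and y: "y \<in> ?I" for x y
  proof -
    have "((Im (?\<psi> y))\<^sup>2 * \<beta>) * (Re (?\<psi> x))\<^sup>2 \<le> (\<alpha> * (Re (?\<psi> y))\<^sup>2) * (Re (?\<psi> x))\<^sup>2"
      by (intro mult_right_mono le[OF y]) simp
    also have "\<dots> = (\<alpha> * (Re (?\<psi> x))\<^sup>2) * (Re (?\<psi> y))\<^sup>2" by (simp add: mult_ac)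
    also have "\<alpha> * (Re (?\<psi> x))\<^sup>2 = (Im (?\<psi> x))\<^sup>2 * \<beta>" using x by (simp add: X_def)
    finally have "\<beta> * ((Im (?\<psi> y))\<^sup>2 * (Re (?\<psi> x))\<^sup>2) \<le> \<beta> * ((Im (?\<psi> x))\<^sup>2 * (Re (?\<psi> y))\<^sup>2)"
      by (simp add: mult_ac)
    then show ?thesis using \<beta> by simp
  qed
  define H where "H = stationary_poly \<omega> p"
  have H: "H \<noteq> 0" "degree H \<le> 2 * degree p"
    using stationary_poly[OF \<omega> p(1)] by (auto simp: H_def)
  define Z where "Z = {z. poly H z = 0}"
  have Z: "finite Z" "card Z \<le> 2 * degree p"
    using H poly_roots_finite[OF H(1)] card_poly_roots_bound[OF H(1)] by (auto simp: Z_def)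
  have "X \<subseteq> {-1, 1} \<union> Im ` Z"
  proof
    fix x assume x: "x \<in> X"
    show "x \<in> {-1, 1} \<union> Im ` Z"
    proof (cases "x = -1 \<or> x = 1")
      case False
      then have "-1 < x" "x < 1" using x by (auto simp: X_def)
      then have "poly H (\<i> * of_real x) = 0"
        unfolding H_def using ext[OF x] re by (intro stationary_point) auto
      then show ?thesis by (intro UnI2 image_eqI[of _ _ "\<i> * of_real x"]) (auto simp: Z_def)
    qed auto
  qed
  moreover have "card ({-1, 1} \<union> Im ` Z) \<le> 2 + card Z"
    using card_Un_le[of "{-1, 1::real}" "Im ` Z"] card_image_le[OF Z(1), of Im] by simp
  ultimately have X: "finite X" "card X \<le> 2 + 2 * degree p"
    using Z finite_subset[of X "{-1, 1} \<union> Im ` Z"] card_mono[of "{-1, 1} \<union> Im ` Z" X] by auto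
  \<comment> \<open>Otherwise the error vanishes identically, and every point is extremal.\<close>
  have "\<alpha> \<noteq> 0"
  proof
    assume "\<alpha> = 0"
    then have "X = ?I" using le \<beta> by (force simp: X_def mult_le_0_iff)
    then show False using X(1) infinite_Icc[of "-1::real" 1] by simp
  qed
  then have \<alpha>: "\<alpha> > 0" by (simp add: \<alpha>_def)
  \<comment> \<open>The sign makes the perturbation turn \<open>\<psi>\<close> towards the real axis at every extremal point.\<close>
  obtain q where q: "degree q \<le> n"
    "\<And>x. x \<in> X \<Longrightarrow> Im (poly q (\<i> * of_real x) * cnj (poly p (\<i> * of_real x))) = - (Re (?\<psi> x) * Im (?\<psi> x))"
    using prescribe_variation[OF cop p(1) _ X(1), of n "\<lambda>x. - (Re (?\<psi> x) * Im (?\<psi> x))"] X(2) p(2) by auto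
  let ?\<chi> = "phased \<omega> q"
  \<comment> \<open>\<open>a + t b + t\<^sup>2 c\<close> is the expansion of \<open>\<beta> (Im \<phi>)\<^sup>2 - \<alpha> (Re \<phi>)\<^sup>2\<close> at \<open>\<phi> = \<psi> + t \<chi>\<close>.\<close>
  define a b c where "a x = (Im (?\<psi> x))\<^sup>2 * \<beta> - \<alpha> * (Re (?\<psi> x))\<^sup>2"
    and "b x = 2 * (\<beta> * (Im (?\<psi> x) * Im (?\<chi> x)) - \<alpha> * (Re (?\<psi> x) * Re (?\<chi> x)))"
    and "c x = (Im (?\<chi> x))\<^sup>2 * \<beta> - \<alpha> * (Re (?\<chi> x))\<^sup>2" for x
  have "\<exists>t>0. \<forall>x\<in>?I. a x + t * b x + t\<^sup>2 * c x < 0"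
  proof (rule uniform_descent)
    fix x assume x: "x \<in> ?I"
    show "a x \<le> 0" using le[OF x] by (simp add: a_def)
    assume "a x = 0"
    then have ax: "(Im (?\<psi> x))\<^sup>2 * \<beta> = \<alpha> * (Re (?\<psi> x))\<^sup>2" by (simp add: a_def)
    then have xX: "x \<in> X" using x by (simp add: X_def)
    have rx: "Re (?\<psi> x) \<noteq> 0" by (rule re[OF x])
    have ix: "Im (?\<psi> x) \<noteq> 0" using ax rx \<alpha> by auto
    have var: "Im (?\<chi> x) * Re (?\<psi> x) - Re (?\<chi> x) * Im (?\<psi> x) = - (Re (?\<psi> x) * Im (?\<psi> x))"
      using q(2)[OF xX] phased_cnj_phased[of \<omega> q x p, THEN arg_cong, of Im] by simp
    have "b x * Re (?\<psi> x) = 2 * (\<beta> * Im (?\<psi> x) * Im (?\<chi> x) * Re (?\<psi> x) - (\<alpha> * (Re (?\<psi> x))\<^sup>2) * Re (?\<chi> x))"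
      by (simp add: b_def power2_eq_square algebra_simps)
    also have "\<dots> = 2 * \<beta> * Im (?\<psi> x) * (Im (?\<chi> x) * Re (?\<psi> x) - Re (?\<chi> x) * Im (?\<psi> x))"
      unfolding ax[symmetric] by (simp add: power2_eq_square algebra_simps)
    also have "\<dots> = - (2 * \<beta> * (Im (?\<psi> x))\<^sup>2) * Re (?\<psi> x)"
      by (simp only: var) (simp add: power2_eq_square algebra_simps)
    finally have "b x = - (2 * \<beta> * (Im (?\<psi> x))\<^sup>2)" using rx by (metis mult_right_cancel)
    then show "b x < 0" using \<beta> ix by simp
  qed (auto simp: a_def b_def c_def intro!: continuous_intros)
  then obtain t where t: "\<And>x. x \<in> ?I \<Longrightarrow> a x + t * b x + t\<^sup>2 * c x < 0" by blast
  define u where "u = p + smult (of_real t) q"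
  let ?\<phi> = "phased \<omega> u"
  have \<phi>: "(Im (?\<phi> x))\<^sup>2 * \<beta> < \<alpha> * (Re (?\<phi> x))\<^sup>2" if "x \<in> ?I" for x
    using t[OF that] by (simp add: u_def phased_add_smult a_def b_def c_def power2_eq_square algebra_simps)
  have unz: "poly u (\<i> * of_real x) \<noteq> 0" if "x \<in> ?I" for x
    using \<phi>[OF that] by (auto simp: phased_def)
  obtain x1 where x1: "x1 \<in> ?I" "exp_error \<omega> (Fract (dagger u) u) = 2 * \<bar>Im (?\<phi> x1)\<bar> / cmod (?\<phi> x1)"
    using exp_error_max[of u \<omega>] unz by blast
  have "\<bar>Im (?\<phi> x1)\<bar> / cmod (?\<phi> x1) < \<bar>Im (?\<psi> x0)\<bar> / cmod (?\<psi> x0)"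
    using \<phi>[OF x1(1)] sine_quotient_le_iff[of "?\<psi> x0" "?\<phi> x1"] unz[OF x1(1)] \<psi>nz[of x0]
    by (simp add: phased_eq_0_iff \<alpha>_def \<beta>_def mult.commute not_le[symmetric])
  then have "exp_error \<omega> (Fract (dagger u) u) < exp_error \<omega> (Fract (dagger p) p)"
    unfolding x1(2) E by linarith
  moreover have "degree u \<le> n" unfolding u_def using q(1) p(2)
    by (intro degree_add_le) (auto intro: order_trans[OF degree_smult_le])
  moreover have "u \<noteq> 0" using unz[of 0] by auto
  ultimately show ?thesis by (auto simp: unitary_rationals_def)
qed

section \<open>Best approximations and the limit of vanishing frequency\<close>

lemma unitary_rational_representative:
  assumes "r \<in> unitary_rationals n"
  obtains p where "p \<noteq> 0" "degree p \<le> n" "coprime (dagger p) p" "r = Fract (dagger p) p"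
  using assms coprime_representative unfolding unitary_rationals_def
  by (smt (verit) mem_Collect_eq order_trans)

text \<open>
  Any representation \<open>a / b\<close> has a denominator divisible by the reduced denominator \<open>p\<close>.
\<close>
lemma min_degree_coprime:
  assumes "coprime (dagger p) p" "p \<noteq> 0"
  shows "min_degree (Fract (dagger p) p) = degree p"
  unfolding min_degree_def
proof (rule Least_equality)
  show "\<exists>a b. b \<noteq> 0 \<and> degree a \<le> degree p \<and> degree b \<le> degree p \<and> Fract (dagger p) p = Fract a b"
    using assms by (intro exI[of _ "dagger p"] exI[of _ p]) simp
next
  fix m assume "\<exists>a b. b \<noteq> 0 \<and> degree a \<le> m \<and> degree b \<le> m \<and> Fract (dagger p) p = Fract a b"
  then obtain a b where ab: "b \<noteq> 0" "degree b \<le> m" "Fract (dagger p) p = Fract a b" by blast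
  then have "dagger p * b = a * p" using assms by (simp add: eq_fract)
  then have "p dvd b" using assms(1)
    by (metis coprime_commute coprime_dvd_mult_right_iff dvd_triv_right)
  then show "degree p \<le> m" using dvd_imp_degree_le[OF _ ab(1)] ab(2) by (meson order_trans)
qed

lemma one_unitary: "1 \<in> unitary_rationals n"
  unfolding unitary_rationals_def by (rule CollectI, rule exI[of _ 1]) (simp add: One_fract_def)

lemma eval_fract_one: "eval_fract 1 z = 1"
  using eval_fract_Fract[of 1 z 1] by (simp add: One_fract_def)

lemma exp_error_one:
  assumes "0 \<le> \<omega>"
  shows "exp_error \<omega> 1 \<le> \<omega>"
  unfolding exp_error_def imag_norm_def
proof (rule cSUP_least)
  fix x :: real assume x: "x \<in> {-1..1}"
  have "cmod (1 - cis (\<omega> * x)) \<le> \<bar>\<omega> * x\<bar>"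
    using dist_exp_i_1[of "\<omega> * x"] abs_sin_x_le_abs_x[of "\<omega> * x / 2"]
    by (simp add: cis_conv_exp norm_minus_commute)
  also have "\<dots> \<le> \<omega> * 1" using x assms unfolding abs_mult by (intro mult_mono) auto
  finally show "cmod (eval_fract 1 (\<i> * of_real x) - exp (of_real \<omega> * (\<i> * of_real x))) \<le> \<omega>"
    by (simp add: eval_fract_one cis_conv_exp mult_ac)
qed simp

text \<open>
  The supremum in \<open>exp_error\<close> is an upper bound only because the error is bounded: the reduced
  denominator has no zeros on the imaginary axis.
\<close>
lemma unitary_pointwise_error_le:
  assumes "r \<in> unitary_rationals n" "x \<in> {-1..1}"
  shows "cmod (eval_fract r (\<i> * of_real x) - exp (of_real \<omega> * (\<i> * of_real x))) \<le> exp_error \<omega> r"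
proof -
  obtain p where p: "coprime (dagger p) p" "r = Fract (dagger p) p"
    using unitary_rational_representative[OF assms(1)] by blast
  note nz = coprime_dagger_imp_poly_imag_nonzero[OF p(1)]
  show ?thesis unfolding p(2) pointwise_error[OF nz] by (rule exp_error_upper[OF nz assms(2)])
qed

theorem proposition9p1:
  fixes n :: nat and r :: "real \<Rightarrow> complex poly fract"
  assumes "n \<ge> 1"
    and best: "\<And>\<omega>. 0 < \<omega> \<Longrightarrow> \<omega> < (real n + 1) * pi \<Longrightarrow> unitary_best_approx n \<omega> (r \<omega>)"
  shows "(\<forall>\<omega>. 0 < \<omega> \<and> \<omega> < (real n + 1) * pi \<longrightarrow> min_degree (r \<omega>) = n)
    \<and> ((\<lambda>\<omega>. imag_norm (\<lambda>z. eval_fract (r \<omega>) z - 1)) \<longlongrightarrow> 0) (at_right 0)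
    \<and> unitary_best_approx n 0 1
    \<and> exp_error 0 1 = 0
    \<and> min_degree 1 < n"
proof (intro conjI allI impI)
  fix \<omega> assume "0 < \<omega> \<and> \<omega> < (real n + 1) * pi"
  then have \<omega>: "0 < \<omega>" "\<omega> < (real n + 1) * pi" by simp_all
  note b = best[OF \<omega>, unfolded unitary_best_approx_def]
  obtain p where p: "p \<noteq> 0" "degree p \<le> n" "coprime (dagger p) p" "r \<omega> = Fract (dagger p) p"
    using unitary_rational_representative[OF conjunct1[OF b]] by blast
  have "exp_error \<omega> (r \<omega>) < 2"
    using exists_error_less_2[OF \<omega>] b by force
  then have "\<not> degree p < n"
    using degenerate_improvable[OF p(3,1) _ \<omega>(1), of n] b p(4) by force
  then show "min_degree (r \<omega>) = n" using p min_degree_coprime by simp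
next
  have bound: "imag_norm (\<lambda>z. eval_fract (r \<omega>) z - 1) \<in> {0..2 * \<omega>}"
    if \<omega>: "0 < \<omega>" "\<omega> < (real n + 1) * pi" for \<omega>
  proof -
    have u: "r \<omega> \<in> unitary_rationals n" and "exp_error \<omega> (r \<omega>) \<le> exp_error \<omega> 1"
      using best[OF \<omega>] one_unitary by (auto simp: unitary_best_approx_def)
    then have e: "exp_error \<omega> (r \<omega>) \<le> \<omega>" using exp_error_one[of \<omega>] \<omega> by linarith
    have le: "cmod (eval_fract (r \<omega>) (\<i> * of_real x) - 1) \<le> 2 * \<omega>" if x: "x \<in> {-1..1}" for x
    proof -
      have "cmod (1 - exp (of_real \<omega> * (\<i> * of_real x))) \<le> \<omega>"
        using unitary_pointwise_error_le[OF one_unitary x, of \<omega>] exp_error_one[of \<omega>] \<omega>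
        by (simp add: eval_fract_one)
      moreover have "cmod (eval_fract (r \<omega>) (\<i> * of_real x) - exp (of_real \<omega> * (\<i> * of_real x))) \<le> \<omega>"
        using unitary_pointwise_error_le[OF u x, of \<omega>] e by linarith
      ultimately show ?thesis by norm
    qed
    have "0 \<le> cmod (eval_fract (r \<omega>) (\<i> * of_real 0) - 1)" by simp
    also have "\<dots> \<le> imag_norm (\<lambda>z. eval_fract (r \<omega>) z - 1)"
      unfolding imag_norm_def using le by (intro cSUP_upper bdd_aboveI2[of _ _ "2 * \<omega>"]) auto
    finally have "0 \<le> imag_norm (\<lambda>z. eval_fract (r \<omega>) z - 1)" .
    moreover have "imag_norm (\<lambda>z. eval_fract (r \<omega>) z - 1) \<le> 2 * \<omega>"
      unfolding imag_norm_def using le by (intro cSUP_least) auto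
    ultimately show ?thesis by simp
  qed
  have ev: "\<forall>\<^sub>F \<omega> in at_right 0. 0 < \<omega> \<and> \<omega> < (real n + 1) * pi"
    by (simp add: eventually_at_right_field) (meson add_nonneg_pos mult_pos_pos of_nat_0_le_iff pi_gt_zero zero_less_one)
  show "((\<lambda>\<omega>. imag_norm (\<lambda>z. eval_fract (r \<omega>) z - 1)) \<longlongrightarrow> 0) (at_right 0)"
  proof (rule tendsto_sandwich[where f = "\<lambda>_. 0" and h = "\<lambda>\<omega>. 2 * \<omega>"])
    show "((\<lambda>\<omega>::real. 2 * \<omega>) \<longlongrightarrow> 0) (at_right 0)"
      by (auto intro!: tendsto_eq_intros)
  qed (use bound in \<open>auto intro!: eventually_mono[OF ev]\<close>)
next
  have nonneg: "0 \<le> exp_error 0 u" if "u \<in> unitary_rationals n" for u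
    using unitary_pointwise_error_le[OF that, of 0 0] norm_ge_zero by (meson order_trans atLeastAtMost_iff neg_le_0_iff_le zero_le_one)
  show "exp_error 0 1 = 0"
    using nonneg[OF one_unitary] exp_error_one[of 0] by simp
  then show "unitary_best_approx n 0 1"
    using nonneg one_unitary by (simp add: unitary_best_approx_def)
next
  have "min_degree 1 = 0"
    using min_degree_coprime[of 1] by (simp add: One_fract_def)
  then show "min_degree 1 < n" using \<open>n \<ge> 1\<close> by simp
qed

end
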